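(* Let $T$ be a tree on $n$ vertices with $M(T)\geq 4$. Then $T$ is $3$-NIM if and only if $T$ is the simple star $S_n$.
   Context: The simple star $S_n$ is the tree $K_{1,n-1}$ (one central vertex adjacent to $n-1$ leaves). For a tree $T$ with vertex set $\{1,\dots,n\}$, $\mathcal{S}(T)$ denotes the set of real symmetric $n\times n$ matrices $A=(a_{ij})$ such that for $i\neq j$, $a_{ij}\neq 0$ if and only if $\{i,j\}$ is an edge of $T$. For $A\in\mathcal{S}(T)$ and $\lambda\in\mathbb{R}$, $\mathrm{m}_A(\lambda)$ is the multiplicity of $\lambda$ as an eigenvalue of $A$, and $M(T)$ is the maximum of $\mathrm{m}_A(\lambda)$ over all $A\in\mathcal{S}(T)$, $\lambda\in\mathbb{R}$. $T$ is $3$-NIM if $M(T)\geq 3$ and, whenever $A\in\mathcal{S}(T)$ has an eigenvalue $\lambda$ with $\mathrm{m}_A(\lambda)=M(T)-2\geq 2$, every other eigenvalue of $A$ has multiplicity $1$. *)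

theory Defs
  imports "Jordan_Normal_Form.Char_Poly"
begin

definition graph_on :: "nat \<Rightarrow> nat set set \<Rightarrow> bool" where
  "graph_on n E \<longleftrightarrow> (\<forall>e\<in>E. \<exists>i j. i < n \<and> j < n \<and> i \<noteq> j \<and> e = {i, j})"

definition adj :: "nat set set \<Rightarrow> nat \<Rightarrow> nat \<Rightarrow> bool" where
  "adj E i j \<longleftrightarrow> {i, j} \<in> E"

definition connected_graph :: "nat \<Rightarrow> nat set set \<Rightarrow> bool" where
  "connected_graph n E \<longleftrightarrow> (\<forall>i<n. \<forall>j<n. (adj E)\<^sup>*\<^sup>* i j)"

definition is_tree :: "nat \<Rightarrow> nat set set \<Rightarrow> bool" where
  "is_tree n E \<longleftrightarrow> n \<ge> 1 \<and> graph_on n E \<and> connected_graph n E \<and> finite E \<and> card E = n - 1"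

definition is_simple_star :: "nat \<Rightarrow> nat set set \<Rightarrow> bool" where
  "is_simple_star n E \<longleftrightarrow> (\<exists>c<n. E = {{c, v} | v. v < n \<and> v \<noteq> c})"

definition S_T :: "nat \<Rightarrow> nat set set \<Rightarrow> real mat set" where
  "S_T n E = {A. A \<in> carrier_mat n n \<and> transpose_mat A = A \<and>
      (\<forall>i<n. \<forall>j<n. i \<noteq> j \<longrightarrow> (A $$ (i, j) \<noteq> 0 \<longleftrightarrow> {i, j} \<in> E))}"

definition mult :: "real mat \<Rightarrow> real \<Rightarrow> nat" where
  "mult A x = order x (char_poly A)"

definition M_T :: "nat \<Rightarrow> nat set set \<Rightarrow> nat" where
  "M_T n E = Sup {mult A x | A x. A \<in> S_T n E}"

definition three_NIM :: "nat \<Rightarrow> nat set set \<Rightarrow> bool" where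
  "three_NIM n E \<longleftrightarrow> M_T n E \<ge> 3 \<and>
     (\<forall>A \<in> S_T n E. \<forall>x. mult A x = M_T n E - 2 \<and> M_T n E - 2 \<ge> 2 \<longrightarrow>
        (\<forall>y. y \<noteq> x \<and> mult A y \<ge> 1 \<longrightarrow> mult A y = 1))"

end

theory Submission
  imports Defs
begin

text \<open>
  Root the tree and eliminate from the leaves: the pivots of \<open>xI - A\<close> are
  \<open>b v = x - a\<^sub>v\<^sub>v - (\<Sum>c. a\<^sub>v\<^sub>c\<^sup>2 / b c)\<close>, summed over the children \<open>c\<close> of \<open>v\<close>. At an eigenvalue
  some pivots vanish and exactly the parents of these have a pole, so the multiplicity is
  \<open>|Z| - |Par Z|\<close>, where \<open>Z\<close> is the set of vertices with pivot zero; \<open>M(T)\<close> is the maximum of this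
  number over all \<open>Z\<close> disjoint from \<open>Par Z\<close>.

  Two zero sets \<open>Z0\<close>, \<open>Z1\<close> can be prescribed for the eigenvalues 0 and 1 of one matrix unless some
  vertex of \<open>Z0 \<inter> Z1\<close> has all its children in \<open>Par Z0 \<inter> Par Z1\<close>. Take \<open>Z\<close> optimal with
  \<open>|Z|\<close> minimal, so every vertex of \<open>Par Z\<close> has at least two children in \<open>Z\<close>. If some \<open>p\<close> has
  exactly three of them, or two vertices have exactly two, hand these children over from \<open>Z\<close> to \<open>Z1\<close>:
  multiplicities \<open>M - 2\<close> and 2. Otherwise some \<open>p\<close> has at least four; hand over two of them and add to
  \<open>Z1\<close> a vertex \<open>x\<close> that is the root or a child of \<open>p\<close> and has a child other than \<open>p\<close>. If there is
  no such \<open>x\<close>, the tree is a star with centre \<open>p\<close>.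
\<close>

section \<open>Auxiliary facts on determinants and orders of vanishing\<close>

text \<open>In the Leibniz expansion a permutation \<open>p\<close> other than the identity with
  nonzero product would strictly increase the sum of \<open>f\<close>, which permuting preserves.
  With the depth as \<open>f\<close>, no reordering of the vertices is needed.\<close>

lemma det_ranked_triangular:
  fixes C :: "'a::comm_ring_1 mat" and f :: "nat \<Rightarrow> nat"
  assumes C: "C \<in> carrier_mat n n"
    and tri: "\<And>i j. i < n \<Longrightarrow> j < n \<Longrightarrow> C $$ (i, j) \<noteq> 0 \<Longrightarrow> i \<noteq> j \<Longrightarrow> f i < f j"
  shows "det C = (\<Prod>i<n. C $$ (i, i))"
proof -
  have zero: "(\<Prod>i = 0..<n. C $$ (i, p i)) = 0" if p: "p permutes {0..<n}" and "p \<noteq> id" for p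
  proof (rule ccontr)
    assume nz: "(\<Prod>i = 0..<n. C $$ (i, p i)) \<noteq> 0"
    have pn: "p i < n" if "i < n" for i using permutes_in_image[OF p, of i] that by simp
    have each: "C $$ (i, p i) \<noteq> 0" if "i < n" for i
      using nz that by (metis atLeast0LessThan finite_lessThan lessThan_iff prod_zero)
    from \<open>p \<noteq> id\<close> obtain i where i: "p i \<noteq> i" by (auto simp: fun_eq_iff)
    then have "i < n" using p by (auto simp: permutes_def)
    have "(\<Sum>i\<in>{0..<n}. f i) < (\<Sum>i\<in>{0..<n}. f (p i))"
    proof (rule sum_strict_mono_ex1)
      show "\<forall>j\<in>{0..<n}. f j \<le> f (p j)"
        using tri[OF _ pn each] by (metis atLeastLessThan_iff less_imp_le order_refl)
      show "\<exists>j\<in>{0..<n}. f j < f (p j)"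
        using tri[OF \<open>i < n\<close> pn[OF \<open>i < n\<close>] each[OF \<open>i < n\<close>]] i \<open>i < n\<close> by auto
    qed simp
    also have "(\<Sum>i\<in>{0..<n}. f (p i)) = (\<Sum>i\<in>{0..<n}. f i)"
      using sum.permute[OF p, of f] by (simp add: o_def)
    finally show False by simp
  qed
  have "det C = (\<Sum>p\<in>{p. p permutes {0..<n}}. signof p * (\<Prod>i = 0..<n. C $$ (i, p i)))"
    by (rule det_def'[OF C])
  also have "\<dots> = (\<Sum>p\<in>{id}. signof p * (\<Prod>i = 0..<n. C $$ (i, p i)))"
    using zero by (intro sum.mono_neutral_right) (auto simp: finite_permutations permutes_id)
  also have "\<dots> = (\<Prod>i<n. C $$ (i, i))" by (simp add: atLeast0LessThan)
  finally show ?thesis .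
qed

text \<open>Were the exponents different, cancelling the smaller power would force one of the two
  limits to be 0. This reads off an order of vanishing from two local factorisations.\<close>

lemma limit_quotient_unique_exponent:
  fixes f g :: "real \<Rightarrow> real"
  assumes f: "(f \<longlongrightarrow> l) (at x0)" and g: "(g \<longlongrightarrow> m) (at x0)" and nz: "l \<noteq> 0" "m \<noteq> 0"
    and eq: "\<forall>\<^sub>F x in at x0. f x * (x - x0) ^ i = g x * (x - x0) ^ j"
  shows "i = j"
proof -
  have aux: "\<not> i < j" if f: "(f \<longlongrightarrow> l) (at x0)" and g: "(g \<longlongrightarrow> m) (at x0)" and "l \<noteq> 0"
    and eq: "\<forall>\<^sub>F x in at x0. f x * (x - x0) ^ i = g x * (x - x0) ^ j"
  for f g :: "real \<Rightarrow> real" and l m i j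
  proof
    assume "i < j"
    have ev: "\<forall>\<^sub>F x in at x0. f x = g x * (x - x0) ^ (j - i)"
      using eq eventually_neq_at_within[of x0 x0 UNIV]
    proof (eventually_elim)
      case (elim x)
      have "f x * (x - x0) ^ i = g x * (x - x0) ^ (j - i) * (x - x0) ^ i"
        using elim(1) \<open>i < j\<close> by (simp add: mult.assoc flip: power_add)
      then show ?case using elim(2) by simp
    qed
    have "((\<lambda>x. g x * (x - x0) ^ (j - i)) \<longlongrightarrow> m * (x0 - x0) ^ (j - i)) (at x0)"
      by (intro tendsto_intros g)
    then have "((\<lambda>x. g x * (x - x0) ^ (j - i)) \<longlongrightarrow> 0) (at x0)" using \<open>i < j\<close> by (simp add: zero_power)
    then have "(f \<longlongrightarrow> 0) (at x0)" using ev tendsto_cong by fastforce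
    then show False using f \<open>l \<noteq> 0\<close> tendsto_unique[OF at_neq_bot] by blast
  qed
  have "\<forall>\<^sub>F x in at x0. g x * (x - x0) ^ j = f x * (x - x0) ^ i"
    using eq by eventually_elim simp
  then show ?thesis using aux[OF f g nz(1) eq] aux[OF g f nz(2)] by (metis nat_neq_iff)
qed

lemma prod_if_power:
  fixes y :: "'a::comm_monoid_mult" and n :: nat
  assumes "Z \<subseteq> {..<n}"
  shows "(\<Prod>v<n. if v \<in> Z then y else 1) = y ^ card Z"
proof -
  have "(\<Prod>v<n. if v \<in> Z then y else 1) = (\<Prod>v\<in>Z. y)"
    using assms by (intro prod.mono_neutral_cong_right) simp_all
  then show ?thesis by simp
qed

section \<open>Rooted trees and recursion over children\<close>

text \<open>The depth rules out cycles. Nothing is said about \<open>par r\<close>, which is why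
  \<open>ch\<close> and \<open>Par\<close> leave out the root.\<close>

locale rooted_tree =
  fixes n r :: nat and par dep :: "nat \<Rightarrow> nat" and E :: "nat set set"
  assumes r_less: "r < n"
    and par_less: "v < n \<Longrightarrow> v \<noteq> r \<Longrightarrow> par v < n"
    and dep_par: "v < n \<Longrightarrow> v \<noteq> r \<Longrightarrow> dep v = Suc (dep (par v))"
    and edges: "E = {{v, par v} | v. v < n \<and> v \<noteq> r}"
begin

definition ch :: "nat \<Rightarrow> nat set" where
  "ch v = {c. c < n \<and> c \<noteq> r \<and> par c = v}"

definition Par :: "nat set \<Rightarrow> nat set" where
  "Par Z = par ` (Z - {r})"

text \<open>A vertex with a child of pivot zero has a pole, so its own pivot is not zero. This is
  the only constraint on the zero set of a single eigenvalue.\<close>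

definition valid :: "nat set \<Rightarrow> bool" where
  "valid Z \<longleftrightarrow> Z \<subseteq> {..<n} \<and> Z \<inter> Par Z = {}"

lemma finite_ch [simp]: "finite (ch v)" by (simp add: ch_def)

lemma ch_less: "c \<in> ch v \<Longrightarrow> c < n" by (simp add: ch_def)

lemma par_ch: "c \<in> ch v \<Longrightarrow> par c = v" by (simp add: ch_def)

lemma dep_ch: "c \<in> ch v \<Longrightarrow> dep c = Suc (dep v)" using dep_par[of c] by (simp add: ch_def)

lemma par_neq: "v < n \<Longrightarrow> v \<noteq> r \<Longrightarrow> par v \<noteq> v" using dep_par by fastforce

lemma edge_iff: "i < n \<Longrightarrow> j < n \<Longrightarrow> {i, j} \<in> E \<longleftrightarrow> i \<in> ch j \<or> j \<in> ch i"
proof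
  assume "{i, j} \<in> E"
  then obtain v where "v < n" "v \<noteq> r" "{i, j} = {v, par v}" unfolding edges by blast
  then have "i = v \<and> j = par v \<or> i = par v \<and> j = v" by (simp only: doubleton_eq_iff)
  with \<open>v < n\<close> \<open>v \<noteq> r\<close> show "i \<in> ch j \<or> j \<in> ch i"
    unfolding ch_def by (elim disjE) simp_all
next
  assume "i \<in> ch j \<or> j \<in> ch i"
  then have "{i, j} = {i, par i} \<and> i < n \<and> i \<noteq> r \<or> {i, j} = {j, par j} \<and> j < n \<and> j \<noteq> r"
    unfolding ch_def by (elim disjE) (simp_all add: insert_commute)
  then show "{i, j} \<in> E" unfolding edges by blast
qed

lemma ch_asym: "i \<in> ch j \<Longrightarrow> j \<notin> ch i"
proof
  assume "i \<in> ch j" "j \<in> ch i"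
  from dep_ch[OF this(1)] dep_ch[OF this(2)] show False by linarith
qed

lemma ch_irrefl: "v \<notin> ch v" using dep_ch by fastforce

lemma finite_valid: "valid Z \<Longrightarrow> finite Z"
  unfolding valid_def using finite_subset by blast

text \<open>Depth grows towards the children but is bounded on the finite vertex set, so its
  distance from the maximum decreases.\<close>

lemma wf_child: "wf {(c, v). c \<in> ch v}"
proof (rule wf_subset[OF wf_measure])
  let ?D = "Max (dep ` {..<n})"
  show "{(c, v). c \<in> ch v} \<subseteq> measure (\<lambda>v. ?D - dep v)"
  proof clarify
    fix c v assume c: "c \<in> ch v"
    then have "dep c = Suc (dep v)" by (rule dep_ch)
    moreover have "dep c \<le> ?D" using c by (intro Max_ge) (auto simp: ch_def)
    ultimately show "(c, v) \<in> measure (\<lambda>v. ?D - dep v)" by auto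
  qed
qed

lemma child_induct: "(\<And>v. (\<And>c. c \<in> ch v \<Longrightarrow> P c) \<Longrightarrow> P v) \<Longrightarrow> P v"
  using wf_induct[OF wf_child, of P v] by auto

text \<open>Stated as an existence claim so that pivots and matrix entries can be defined from the
  leaves upwards inside a proof.\<close>

lemma child_recursion:
  fixes F :: "(nat \<Rightarrow> 'b) \<Rightarrow> nat \<Rightarrow> 'b"
  assumes "\<And>v f g. (\<And>c. c \<in> ch v \<Longrightarrow> f c = g c) \<Longrightarrow> F f v = F g v"
  shows "\<exists>f. \<forall>v. f v = F f v"
proof -
  have "adm_wf {(c, v). c \<in> ch v} F" 
    unfolding adm_wf_def by (intro allI impI, rule assms) simp
  from fun_cong[OF wfrec_fixpoint[OF wf_child this]] show ?thesis by blast
qed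

text \<open>The tree structure makes \<open>B = L D L\<^sup>T\<close> without fill-in, where \<open>L\<close> is unitriangular with
  respect to the depth.\<close>

lemma det_tree:
  fixes B :: "real mat"
  assumes B: "B \<in> carrier_mat n n" and sym: "transpose_mat B = B"
    and supp: "\<And>i j. i < n \<Longrightarrow> j < n \<Longrightarrow> i \<noteq> j \<Longrightarrow> B $$ (i, j) \<noteq> 0 \<Longrightarrow> i \<in> ch j \<or> j \<in> ch i"
    and a: "\<And>v. v < n \<Longrightarrow> a v \<noteq> 0"
    and rec: "\<And>v. v < n \<Longrightarrow> B $$ (v, v) = a v + (\<Sum>c\<in>ch v. (B $$ (v, c))\<^sup>2 / a c)"
  shows "det B = (\<Prod>v<n. a v)"
proof -
  have symB: "B $$ (i, j) = B $$ (j, i)" if "i < n" "j < n" for i j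
    using sym B that by (metis carrier_matD index_transpose_mat(1))
  define l where "l i k = (if k = i then 1 else if k \<in> ch i then B $$ (i, k) / a k else 0)" for i k
  define L where "L = mat n n (\<lambda>(i, k). l i k)"
  define U where "U = mat n n (\<lambda>(k, j). a k * l j k)"
  have L: "L \<in> carrier_mat n n" and U: "U \<in> carrier_mat n n" by (auto simp: L_def U_def)
  have rank: "dep i < dep k" if "l i k \<noteq> 0" "i \<noteq> k" for i k
    using that dep_ch[of k i] by (auto simp: l_def split: if_splits)
  have "det L = (\<Prod>i<n. L $$ (i, i))"
    by (rule det_ranked_triangular[OF L, of dep]) (auto simp: L_def rank)
  then have detL: "det L = 1" by (simp add: L_def l_def)
  have "det (transpose_mat U) = (\<Prod>i<n. transpose_mat U $$ (i, i))"
    by (rule det_ranked_triangular[of _ n dep]) (auto simp: U_def rank)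
  then have detU: "det U = (\<Prod>i<n. a i)" using det_transpose[OF U] by (simp add: U_def l_def)
  have "B = L * U"
  proof (rule eq_matI)
    fix i j assume "i < dim_row (L * U)" "j < dim_col (L * U)"
    then have ij: "i < n" "j < n" by (auto simp: L_def U_def)
    have "(L * U) $$ (i, j) = (\<Sum>k<n. l i k * (a k * l j k))"
      using ij by (simp add: L_def U_def scalar_prod_def atLeast0LessThan)
    also have "\<dots> = B $$ (i, j)"
    proof (cases "i = j")
      case True
      have "(\<Sum>k<n. l i k * (a k * l i k)) = (\<Sum>k\<in>insert i (ch i). l i k * (a k * l i k))"
        using ij by (intro sum.mono_neutral_right) (auto simp: l_def ch_less)
      also have "\<dots> = a i + (\<Sum>k\<in>ch i. l i k * (a k * l i k))"
        by (simp add: ch_irrefl l_def)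
      also have "(\<Sum>k\<in>ch i. l i k * (a k * l i k)) = (\<Sum>k\<in>ch i. (B $$ (i, k))\<^sup>2 / a k)"
        using a ch_irrefl by (intro sum.cong) (auto simp: l_def power2_eq_square ch_less)
      finally show ?thesis using rec[OF ij(1)] True by simp
    next
      case False
      \<comment> \<open>A third vertex \<open>k\<close> would have to be a child of both
        \<open>i\<close> and \<open>j\<close>, but its parent is unique. This is the absence of
        fill-in.\<close>
      have nil: "l i k * (a k * l j k) = 0" if "k \<noteq> i" "k \<noteq> j" for k
        using that False par_ch by (auto simp: l_def)
      have "(\<Sum>k<n. l i k * (a k * l j k)) = (\<Sum>k\<in>{i, j}. l i k * (a k * l j k))"
        using ij nil by (intro sum.mono_neutral_right) auto
      also have "\<dots> = a i * l j i + l i j * a j"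
        using False by (simp add: l_def)
      also have "\<dots> = B $$ (i, j)"
        using False supp[OF ij False] ch_asym[of i j] ch_asym[of j i] a ij symB[OF ij] by (auto simp: l_def)
      finally show ?thesis .
    qed
    finally show "B $$ (i, j) = (L * U) $$ (i, j)" by simp
  qed (use B in \<open>auto simp: L_def U_def\<close>)
  then show ?thesis using det_mult[OF L U] detL detU by simp
qed

section \<open>Zero sets, pivots and multiplicities\<close>

lemma Par_iff: "valid Z \<Longrightarrow> v \<in> Par Z \<longleftrightarrow> ch v \<inter> Z \<noteq> {}"
  unfolding valid_def Par_def ch_def by auto

lemma Par_subset: "valid Z \<Longrightarrow> Par Z \<subseteq> {..<n}"
  unfolding valid_def Par_def using par_less by auto

lemma valid_disjoint: "valid Z \<Longrightarrow> v \<in> Z \<Longrightarrow> v \<notin> Par Z"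
  unfolding valid_def by auto

text \<open>\<open>a\<close> holds the pivots at \<open>x\<close>. On \<open>Par Z\<close> they are
  infinite: there \<open>a\<close> is unconstrained, and such children contribute 0 to the sum at
  their parent.\<close>

definition labelling :: "real mat \<Rightarrow> real \<Rightarrow> nat set \<Rightarrow> (nat \<Rightarrow> real) \<Rightarrow> bool" where
  "labelling A x Z a \<longleftrightarrow> valid Z \<and> (\<forall>v<n. v \<notin> Par Z \<longrightarrow>
     a v = x - A $$ (v, v) - (\<Sum>c\<in>ch v - Par Z. (A $$ (v, c))\<^sup>2 / a c) \<and> (a v = 0 \<longleftrightarrow> v \<in> Z))"

text \<open>Elimination from the leaves upwards with values in \<open>real option\<close>, where
  \<open>None\<close> stands for a pole and arises exactly from a child with value 0.\<close>

lemma labelling_exists: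
  assumes "A \<in> S_T n E"
  obtains Z a where "labelling A x Z a"
proof -
  define F where "F f v = (if \<exists>c\<in>ch v. f c = Some 0 then None else
    Some (x - A $$ (v, v) - (\<Sum>c\<in>ch v. case f c of None \<Rightarrow> 0 | Some y \<Rightarrow> (A $$ (v, c))\<^sup>2 / y)))"
    for f :: "nat \<Rightarrow> real option" and v
  have "\<exists>lab. \<forall>v. lab v = F lab v"
    by (rule child_recursion) (simp add: F_def cong: sum.cong)
  then obtain lab where lab: "lab v = F lab v" for v by blast
  define Z where "Z = {v. v < n \<and> lab v = Some 0}"
  have Par: "Par Z = {v. \<exists>c\<in>ch v. lab c = Some 0}"
    unfolding Par_def Z_def ch_def by auto
  then have None: "lab v = None \<longleftrightarrow> v \<in> Par Z" for v
    unfolding lab[of v] by (auto simp: F_def)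
  have val: "valid Z"
    unfolding valid_def using None[symmetric] by (auto simp: Z_def)
  have eqs: "the (lab v) = x - A $$ (v, v) - (\<Sum>c\<in>ch v - Par Z. (A $$ (v, c))\<^sup>2 / the (lab c)) \<and>
      (the (lab v) = 0 \<longleftrightarrow> v \<in> Z)" if "v < n" "v \<notin> Par Z" for v
  proof
    have "(\<Sum>c\<in>ch v. case lab c of None \<Rightarrow> 0 | Some y \<Rightarrow> (A $$ (v, c))\<^sup>2 / y) =
        (\<Sum>c\<in>ch v - Par Z. (A $$ (v, c))\<^sup>2 / the (lab c))"
      by (intro sum.mono_neutral_cong_right) (auto simp flip: None split: option.splits)
    moreover have "\<not> (\<exists>c\<in>ch v. lab c = Some 0)" using that(2) Par by auto
    ultimately show "the (lab v) = x - A $$ (v, v) - (\<Sum>c\<in>ch v - Par Z. (A $$ (v, c))\<^sup>2 / the (lab c))"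
      by (subst lab) (simp add: F_def)
    show "the (lab v) = 0 \<longleftrightarrow> v \<in> Z"
      using that None[of v] by (auto simp: Z_def)
  qed
  have "labelling A x Z (\<lambda>v. the (lab v))"
    unfolding labelling_def by (intro conjI[OF val] allI impI) (rule eqs)
  then show thesis by (rule that)
qed

lemma S_T_sym: "A \<in> S_T n E \<Longrightarrow> i < n \<Longrightarrow> j < n \<Longrightarrow> A $$ (i, j) = A $$ (j, i)"
  unfolding S_T_def using index_transpose_mat(1)[of i A j] by auto

lemma S_T_child: "A \<in> S_T n E \<Longrightarrow> v < n \<Longrightarrow> c \<in> ch v \<Longrightarrow> A $$ (v, c) \<noteq> 0"
  using ch_less[of c v] ch_irrefl edge_iff[of v c] unfolding S_T_def by auto

lemma char_poly_tree:
  assumes A: "A \<in> S_T n E"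
    and b: "\<And>v. v < n \<Longrightarrow> b v \<noteq> 0"
    and rec: "\<And>v. v < n \<Longrightarrow> b v = t - A $$ (v, v) - (\<Sum>c\<in>ch v. (A $$ (v, c))\<^sup>2 / b c)"
  shows "poly (char_poly A) t = (\<Prod>v<n. b v)"
proof -
  have carr: "A \<in> carrier_mat n n" using A by (simp add: S_T_def)
  \<comment> \<open>\<open>char_matrix A t\<close> is \<open>A - t I\<close>, hence the
    sign.\<close>
  let ?B = "- char_matrix A t"
  have entry: "?B $$ (i, j) = (if i = j then t else 0) - A $$ (i, j)" if "i < n" "j < n" for i j
    using that carr by (auto simp: char_matrix_def)
  have "det ?B = (\<Prod>v<n. b v)"
  proof (rule det_tree)
    show "?B \<in> carrier_mat n n" using carr by simp
    show "transpose_mat ?B = ?B"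
    proof (rule eq_matI)
      have dims: "dim_row ?B = n" "dim_col ?B = n" using carr by (simp_all add: char_matrix_def)
      fix i j assume "i < dim_row ?B" "j < dim_col ?B"
      then have ij: "i < n" "j < n" by (simp_all only: dims)
      then have "transpose_mat ?B $$ (i, j) = ?B $$ (j, i)"
        by (intro index_transpose_mat(1)) (simp_all only: dims)
      then show "transpose_mat ?B $$ (i, j) = ?B $$ (i, j)"
        using entry[OF ij] entry[OF ij(2,1)] S_T_sym[OF A ij] by simp
    qed (use carr in \<open>simp_all add: char_matrix_def\<close>)
    show "i \<in> ch j \<or> j \<in> ch i" if "i < n" "j < n" "i \<noteq> j" "?B $$ (i, j) \<noteq> 0" for i j
    proof -
      have "A $$ (i, j) \<noteq> 0" using that(3,4) entry[OF that(1,2)] by simp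
      then show ?thesis using A that edge_iff[OF that(1,2)] by (auto simp: S_T_def)
    qed
    show "b v \<noteq> 0" if "v < n" for v using b that .
    show "?B $$ (v, v) = b v + (\<Sum>c\<in>ch v. (?B $$ (v, c))\<^sup>2 / b c)" if v: "v < n" for v
    proof -
      have "?B $$ (v, c) = - A $$ (v, c)" if "c \<in> ch v" for c
        using entry[OF v ch_less[OF that]] that ch_irrefl by auto
      then have "(\<Sum>c\<in>ch v. (?B $$ (v, c))\<^sup>2 / b c) = (\<Sum>c\<in>ch v. (A $$ (v, c))\<^sup>2 / b c)"
        by (intro sum.cong) simp_all
      then show ?thesis using rec[OF v] entry[OF v v] by simp
    qed
  qed
  then show ?thesis using char_poly_matrix[OF carr] by simp
qed

text \<open>The pivots are rational functions of the spectral parameter, increasing away from their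
  poles. Hence zeros and poles are simple, and the multiplicity counts zeros minus poles.\<close>

lemma pivot_asymptotics:
  assumes A: "A \<in> S_T n E" and lab: "labelling A x Z a"
    and b: "\<And>v t. b v t = t - A $$ (v, v) - (\<Sum>c\<in>ch v. (A $$ (v, c))\<^sup>2 / b c t)"
    and "v < n"
  shows "(v \<notin> Par Z \<longrightarrow> (\<exists>g>0. ((\<lambda>t. (b v t - a v) / (t - x)) \<longlongrightarrow> g) (at x))) \<and>
    (v \<in> Par Z \<longrightarrow> (\<exists>g<0. ((\<lambda>t. b v t * (t - x)) \<longlongrightarrow> g) (at x)))"
  using \<open>v < n\<close>
proof (induction v rule: child_induct)
  case (1 v)
  have Z: "valid Z" and arec: "\<And>v. v < n \<Longrightarrow> v \<notin> Par Z \<Longrightarrow>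
      a v = x - A $$ (v, v) - (\<Sum>c\<in>ch v - Par Z. (A $$ (v, c))\<^sup>2 / a c)"
    and a0: "\<And>v. v < n \<Longrightarrow> v \<notin> Par Z \<Longrightarrow> a v = 0 \<longleftrightarrow> v \<in> Z"
    using lab unfolding labelling_def by auto
  have ne: "\<forall>\<^sub>F t in at x. t \<noteq> x" by (rule eventually_neq_at_within)
  have dx: "((\<lambda>t. t - x) \<longlongrightarrow> 0) (at x)" by (rule LIM_zero) (rule tendsto_ident_at)
  have fin: "\<exists>g>0. ((\<lambda>t. (b c t - a c) / (t - x)) \<longlongrightarrow> g) (at x)" if "c \<in> ch v" "c \<notin> Par Z" for c
    using "1.IH"[OF that(1) ch_less[OF that(1)]] that(2) by simp
  have pole: "\<exists>g<0. ((\<lambda>t. b c t * (t - x)) \<longlongrightarrow> g) (at x)" if "c \<in> ch v" "c \<in> Par Z" for c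
    using "1.IH"[OF that(1) ch_less[OF that(1)]] that(2) by simp
  have cont: "((\<lambda>t. b c t) \<longlongrightarrow> a c) (at x)" if "c \<in> ch v" "c \<notin> Par Z" for c
  proof -
    from fin[OF that] obtain g where "((\<lambda>t. (b c t - a c) / (t - x)) \<longlongrightarrow> g) (at x)" by blast
    from tendsto_add[OF tendsto_mult[OF this dx] tendsto_const[of "a c"]]
    have "((\<lambda>t. (b c t - a c) / (t - x) * (t - x) + a c) \<longlongrightarrow> a c) (at x)" by simp
    moreover have "\<forall>\<^sub>F t in at x. (b c t - a c) / (t - x) * (t - x) + a c = b c t"
      using ne by eventually_elim simp
    ultimately show ?thesis by (rule Lim_transform_eventually)
  qed
  show ?case
  proof (intro conjI impI)
    assume v: "v \<notin> Par Z"
    \<comment> \<open>\<open>s c\<close> is the limit at \<open>x\<close> of the term of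
      \<open>c\<close>; a pole of \<open>b c\<close> makes it 0.\<close>
    define s where "s c = (if c \<in> Par Z then 0 else (A $$ (v, c))\<^sup>2 / a c)" for c
    have lim: "\<exists>l\<le>0. ((\<lambda>t. ((A $$ (v, c))\<^sup>2 / b c t - s c) / (t - x)) \<longlongrightarrow> l) (at x)" if c: "c \<in> ch v" for c
    proof (cases "c \<in> Par Z")
      case True
      from pole[OF c True] obtain g where g: "g < 0" "((\<lambda>t. b c t * (t - x)) \<longlongrightarrow> g) (at x)" by blast
      have "((\<lambda>t. (A $$ (v, c))\<^sup>2 / (b c t * (t - x))) \<longlongrightarrow> (A $$ (v, c))\<^sup>2 / g) (at x)"
        using g by (intro tendsto_intros) auto
      moreover have "(A $$ (v, c))\<^sup>2 / g \<le> 0" using g by (simp add: divide_nonneg_neg)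
      ultimately show ?thesis using True by (auto simp: s_def)
    next
      case False
      have "a c \<noteq> 0" using a0[OF ch_less[OF c] False] v c Z by (auto simp: Par_iff)
      from fin[OF c False] obtain g where g: "g > 0" "((\<lambda>t. (b c t - a c) / (t - x)) \<longlongrightarrow> g) (at x)" by blast
      have lim: "((\<lambda>t. - (A $$ (v, c))\<^sup>2 * ((b c t - a c) / (t - x)) / (b c t * a c)) \<longlongrightarrow>
          - (A $$ (v, c))\<^sup>2 * g / (a c * a c)) (at x)"
        using \<open>a c \<noteq> 0\<close> by (intro tendsto_intros g cont[OF c False]) simp
      have nonpos: "- (A $$ (v, c))\<^sup>2 * g / (a c * a c) \<le> 0" using g by (simp add: divide_nonpos_nonneg)
      have "\<forall>\<^sub>F t in at x. b c t \<noteq> 0"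
        by (rule tendsto_imp_eventually_ne[OF cont[OF c False] \<open>a c \<noteq> 0\<close>])
      then have "\<forall>\<^sub>F t in at x. - (A $$ (v, c))\<^sup>2 * ((b c t - a c) / (t - x)) / (b c t * a c) =
          ((A $$ (v, c))\<^sup>2 / b c t - s c) / (t - x)"
        using ne
      proof eventually_elim
        case (elim t)
        then show ?case using False \<open>a c \<noteq> 0\<close> unfolding s_def by (simp add: field_simps)
      qed
      from Lim_transform_eventually[OF lim this] nonpos show ?thesis by blast
    qed
    then obtain l where l: "\<And>c. c \<in> ch v \<Longrightarrow> l c \<le> 0"
      "\<And>c. c \<in> ch v \<Longrightarrow> ((\<lambda>t. ((A $$ (v, c))\<^sup>2 / b c t - s c) / (t - x)) \<longlongrightarrow> l c) (at x)"
      by metis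
    have lim1: "((\<lambda>t. 1 - (\<Sum>c\<in>ch v. ((A $$ (v, c))\<^sup>2 / b c t - s c) / (t - x))) \<longlongrightarrow> 1 - (\<Sum>c\<in>ch v. l c)) (at x)"
      by (intro tendsto_intros l)
    \<comment> \<open>The summand \<open>t\<close> has slope 1, and no child lowers this since its
      pivot increases or has a pole of negative residue.\<close>
    have pos: "1 - (\<Sum>c\<in>ch v. l c) > 0" using sum_nonpos[of "ch v" l] l(1) by simp
    have "\<forall>\<^sub>F t in at x. 1 - (\<Sum>c\<in>ch v. ((A $$ (v, c))\<^sup>2 / b c t - s c) / (t - x)) = (b v t - a v) / (t - x)"
      using ne
    proof eventually_elim
      case (elim t)
      have "(\<Sum>c\<in>ch v. s c) = (\<Sum>c\<in>ch v - Par Z. (A $$ (v, c))\<^sup>2 / a c)"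
        by (intro sum.mono_neutral_cong_right) (auto simp: s_def)
      then have "b v t - a v = (t - x) - (\<Sum>c\<in>ch v. (A $$ (v, c))\<^sup>2 / b c t - s c)"
        using arec[OF \<open>v < n\<close> v] b[of v t] by (simp add: sum_subtractf)
      then have "(b v t - a v) / (t - x) = 1 - (\<Sum>c\<in>ch v. (A $$ (v, c))\<^sup>2 / b c t - s c) / (t - x)"
        using elim by (simp add: diff_divide_distrib)
      then show ?case by (simp only: sum_divide_distrib)
    qed
    from Lim_transform_eventually[OF lim1 this] pos
    show "\<exists>g>0. ((\<lambda>t. (b v t - a v) / (t - x)) \<longlongrightarrow> g) (at x)" by blast
  next
    assume v: "v \<in> Par Z"
    \<comment> \<open>After multiplication by \<open>t - x\<close> only the children in
      \<open>Z\<close> survive in the limit. Each of them has a positive one, which makes the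
      residue at \<open>v\<close> negative.\<close>
    have lim: "\<exists>l\<ge>0. ((\<lambda>t. (t - x) / b c t) \<longlongrightarrow> l) (at x) \<and> (c \<in> Z \<longrightarrow> l > 0)" if c: "c \<in> ch v" for c
    proof (cases "c \<in> Par Z")
      case True
      from pole[OF c True] obtain g where g: "g < 0" "((\<lambda>t. b c t * (t - x)) \<longlongrightarrow> g) (at x)" by blast
      have "((\<lambda>t. (t - x) * (t - x) / (b c t * (t - x))) \<longlongrightarrow> 0 * 0 / g) (at x)"
        using g by (intro tendsto_intros dx) auto
      moreover have "\<forall>\<^sub>F t in at x. (t - x) * (t - x) / (b c t * (t - x)) = (t - x) / b c t"
        using ne by eventually_elim simp
      ultimately have "((\<lambda>t. (t - x) / b c t) \<longlongrightarrow> 0 * 0 / g) (at x)"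
        by (rule Lim_transform_eventually)
      then show ?thesis using True valid_disjoint[OF Z] by auto
    next
      case False
      show ?thesis
      proof (cases "c \<in> Z")
        case True
        then have "a c = 0" using a0[OF ch_less[OF c] False] by simp
        from fin[OF c False] obtain g where g: "g > 0" "((\<lambda>t. (b c t - a c) / (t - x)) \<longlongrightarrow> g) (at x)" by blast
        then have "((\<lambda>t. inverse ((b c t - a c) / (t - x))) \<longlongrightarrow> inverse g) (at x)"
          by (intro tendsto_intros) auto
        then show ?thesis using g \<open>a c = 0\<close> by (intro exI[of _ "inverse g"]) simp
      next
        case nz: False
        then have "a c \<noteq> 0" using a0[OF ch_less[OF c] False] by simp
        then have "((\<lambda>t. (t - x) / b c t) \<longlongrightarrow> 0 / a c) (at x)"
          by (intro tendsto_intros dx cont[OF c False])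
        then show ?thesis using nz by auto
      qed
    qed
    then obtain l where l: "\<And>c. c \<in> ch v \<Longrightarrow> l c \<ge> 0" "\<And>c. c \<in> ch v \<Longrightarrow> c \<in> Z \<Longrightarrow> l c > 0"
      "\<And>c. c \<in> ch v \<Longrightarrow> ((\<lambda>t. (t - x) / b c t) \<longlongrightarrow> l c) (at x)"
      by metis
    have "((\<lambda>t. (t - A $$ (v, v)) * (t - x) - (\<Sum>c\<in>ch v. (A $$ (v, c))\<^sup>2 * ((t - x) / b c t))) \<longlongrightarrow>
        (x - A $$ (v, v)) * 0 - (\<Sum>c\<in>ch v. (A $$ (v, c))\<^sup>2 * l c)) (at x)"
      by (intro tendsto_intros l dx)
    then have "((\<lambda>t. b v t * (t - x)) \<longlongrightarrow> (x - A $$ (v, v)) * 0 - (\<Sum>c\<in>ch v. (A $$ (v, c))\<^sup>2 * l c)) (at x)"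
      by (subst b) (simp add: left_diff_distrib sum_distrib_right)
    moreover have "(\<Sum>c\<in>ch v. (A $$ (v, c))\<^sup>2 * l c) > 0"
    proof -
      from v obtain c where c: "c \<in> ch v" "c \<in> Z" using Par_iff[OF Z] by blast
      show ?thesis
        using c l S_T_child[OF A \<open>v < n\<close> c(1)] by (intro sum_pos2[OF _ c(1)]) auto
    qed
    ultimately show "\<exists>g<0. ((\<lambda>t. b v t * (t - x)) \<longlongrightarrow> g) (at x)"
      by (intro exI conjI) (auto simp del: mult_zero_right)
  qed
qed

text \<open>The factorisation into pivots is available near \<open>x\<close> but not at
  \<open>x\<close>, so orders of vanishing are compared there. The additive form avoids truncated
  subtraction.\<close>

lemma mult_labelling:
  assumes A: "A \<in> S_T n E" and lab: "labelling A x Z a"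
  shows "mult A x + card (Par Z) = card Z"
proof -
  have Z: "valid Z" and a0: "\<And>v. v < n \<Longrightarrow> v \<notin> Par Z \<Longrightarrow> a v = 0 \<longleftrightarrow> v \<in> Z"
    using lab unfolding labelling_def by auto
  have "\<exists>b. \<forall>v. b v = (\<lambda>t. t - A $$ (v, v) - (\<Sum>c\<in>ch v. (A $$ (v, c))\<^sup>2 / b c t))"
    by (rule child_recursion) (simp cong: sum.cong)
  then obtain b where "\<forall>v. b v = (\<lambda>t. t - A $$ (v, v) - (\<Sum>c\<in>ch v. (A $$ (v, c))\<^sup>2 / b c t))" ..
  then have "b v = (\<lambda>t. t - A $$ (v, v) - (\<Sum>c\<in>ch v. (A $$ (v, c))\<^sup>2 / b c t))" for v by (rule spec)
  then have b: "b v t = t - A $$ (v, v) - (\<Sum>c\<in>ch v. (A $$ (v, c))\<^sup>2 / b c t)" for v t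
    by (rule fun_cong)
  have ne: "\<forall>\<^sub>F t in at x. t \<noteq> x" by (rule eventually_neq_at_within)
  have dx: "((\<lambda>t. t - x) \<longlongrightarrow> 0) (at x)" by (rule LIM_zero) (rule tendsto_ident_at)
  \<comment> \<open>The pivots with their simple zero or pole at \<open>x\<close> removed, so that
    every limit is finite and nonzero.\<close>
  define h where "h v t = (if v \<in> Z then b v t / (t - x) else if v \<in> Par Z then b v t * (t - x) else b v t)"
    for v t
  have "\<exists>l. l \<noteq> 0 \<and> (h v \<longlongrightarrow> l) (at x)" if v: "v < n" for v
  proof -
    note asym = pivot_asymptotics[OF A lab b v]
    consider "v \<in> Z" "v \<notin> Par Z" | "v \<notin> Z" "v \<in> Par Z" | "v \<notin> Z" "v \<notin> Par Z"
      using valid_disjoint[OF Z] by blast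
    then show ?thesis
    proof cases
      case 1
      then have "h v = (\<lambda>t. (b v t - a v) / (t - x))" using a0[OF v] by (auto simp: h_def)
      then show ?thesis using asym 1 by (metis less_irrefl)
    next
      case 2
      then have "h v = (\<lambda>t. b v t * (t - x))" by (auto simp: h_def)
      then show ?thesis using asym 2 by (metis less_irrefl)
    next
      case 3
      from asym 3 obtain g where "((\<lambda>t. (b v t - a v) / (t - x)) \<longlongrightarrow> g) (at x)" by blast
      from tendsto_add[OF tendsto_mult[OF this dx] tendsto_const[of "a v"]]
      have "((\<lambda>t. (b v t - a v) / (t - x) * (t - x) + a v) \<longlongrightarrow> a v) (at x)" by simp
      moreover have "\<forall>\<^sub>F t in at x. (b v t - a v) / (t - x) * (t - x) + a v = h v t"
        using ne by eventually_elim (simp add: h_def 3)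
      ultimately have "(h v \<longlongrightarrow> a v) (at x)" by (rule Lim_transform_eventually)
      then show ?thesis using a0[OF v] 3 by blast
    qed
  qed
  then obtain l where l: "\<And>v. v < n \<Longrightarrow> l v \<noteq> 0" "\<And>v. v < n \<Longrightarrow> (h v \<longlongrightarrow> l v) (at x)" by metis
  define p where "p = char_poly A"
  have "A \<in> carrier_mat n n" using A by (simp add: S_T_def)
  from degree_monic_char_poly[OF this] have "p \<noteq> 0" by (auto simp: p_def)
  from order_decomp[OF this, of x] obtain q where q: "p = [:- x, 1:] ^ mult A x * q" "\<not> [:- x, 1:] dvd q"
    unfolding mult_def p_def by blast
  have qx: "poly q x \<noteq> 0" using q(2) by (simp add: poly_eq_0_iff_dvd)
  \<comment> \<open>In a punctured neighbourhood no pivot vanishes, as \<open>char_poly_tree\<close>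
    requires.\<close>
  have "\<forall>\<^sub>F t in at x. \<forall>v\<in>{..<n}. h v t \<noteq> 0"
    using l by (intro eventually_ball_finite ballI) (auto intro!: tendsto_imp_eventually_ne)
  then have ev: "\<forall>\<^sub>F t in at x. poly q t * (t - x) ^ (mult A x + card (Par Z)) =
      (\<Prod>v<n. h v t) * (t - x) ^ card Z"
    using ne
  proof eventually_elim
    case (elim t)
    have "b v t \<noteq> 0" if "v < n" for v using elim(1) that by (auto simp: h_def split: if_splits)
    then have "poly p t = (\<Prod>v<n. b v t)"
      unfolding p_def by (rule char_poly_tree[OF A, where b = "\<lambda>v. b v t", OF _ b])
    moreover have "poly p t = (t - x) ^ mult A x * poly q t" by (simp add: q(1) poly_power)
    moreover have "(\<Prod>v<n. h v t) * (t - x) ^ card Z = (\<Prod>v<n. b v t) * (t - x) ^ card (Par Z)"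
    proof -
      have sub: "Z \<subseteq> {..<n}" using Z by (simp add: valid_def)
      have "h v t * (if v \<in> Z then t - x else 1) = b v t * (if v \<in> Par Z then t - x else 1)" for v
        using valid_disjoint[OF Z] elim(2) by (auto simp: h_def)
      then have "(\<Prod>v<n. h v t * (if v \<in> Z then t - x else 1)) = (\<Prod>v<n. b v t * (if v \<in> Par Z then t - x else 1))"
        by simp
      then show ?thesis
        by (simp add: prod.distrib prod_if_power[OF sub] prod_if_power[OF Par_subset[OF Z]])
    qed
    ultimately show ?case by (simp add: power_add algebra_simps)
  qed
  have "((\<lambda>t. \<Prod>v<n. h v t) \<longlongrightarrow> (\<Prod>v<n. l v)) (at x)" using l(2) by (intro tendsto_prod) auto
  moreover have "(\<Prod>v<n. l v) \<noteq> 0" using l(1) by simp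
  moreover have "((\<lambda>t. poly q t) \<longlongrightarrow> poly q x) (at x)" using poly_isCont isCont_def by blast
  ultimately show ?thesis
    using limit_quotient_unique_exponent[OF _ _ qx _ ev] by blast
qed


section \<open>Prescribing the zero sets of two eigenvalues\<close>

text \<open>Edges to the children of \<open>v\<close> all carry the squared weight \<open>W f v\<close>, so the two pivots
  at \<open>v\<close>, for eigenvalues 0 and 1, differ by \<open>1 - W f v * H f v\<close>. This must vanish if \<open>v\<close> lies
  in both zero sets, and is kept positive otherwise.\<close>

lemma realize_pair:
  assumes Z0: "valid Z0" and Z1: "valid Z1"
    and both: "\<And>v. v \<in> Z0 \<Longrightarrow> v \<in> Z1 \<Longrightarrow> \<exists>c\<in>ch v. \<not> (c \<in> Par Z0 \<and> c \<in> Par Z1)"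
  obtains A where "A \<in> S_T n E" "mult A 0 + card (Par Z0) = card Z0" "mult A 1 + card (Par Z1) = card Z1"
proof -
  \<comment> \<open>\<open>f v\<close> will be the pair of pivots of \<open>v\<close> at the
    parameters 0 and 1. A pole is again dropped from the sums of reciprocals.\<close>
  define R0 where "R0 f v = (\<Sum>c\<in>ch v - Par Z0. 1 / fst (f c))" for f :: "nat \<Rightarrow> real \<times> real" and v
  define R1 where "R1 f v = (\<Sum>c\<in>ch v - Par Z1. 1 / snd (f c))" for f :: "nat \<Rightarrow> real \<times> real" and v
  define H where "H f v = R1 f v - R0 f v" for f v
  define W where "W f v = (if v \<in> Z0 \<and> v \<in> Z1 then 1 / H f v else 1 / (2 * (\<bar>H f v\<bar> + 1)))" for f v
  \<comment> \<open>The first two cases make the required pivot zero. If only one pivot of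
    \<open>v\<close> is finite, the next two make it 1 or -1; otherwise the last case places the two
    pivots symmetrically about 0.\<close>
  define D where "D f v =
    (if v \<in> Z0 then - W f v * R0 f v
     else if v \<in> Z1 then 1 - W f v * R1 f v
     else if v \<in> Par Z0 then - W f v * R1 f v
     else if v \<in> Par Z1 then 1 - W f v * R0 f v
     else (1 - W f v * H f v) / 2 - W f v * R0 f v)" for f v
  define F where "F f v = (- D f v - W f v * R0 f v, 1 - D f v - W f v * R1 f v)" for f v
  have "\<exists>f. \<forall>v. f v = F f v"
  proof (rule child_recursion)
    fix v and f g :: "nat \<Rightarrow> real \<times> real" assume fg: "\<And>c. c \<in> ch v \<Longrightarrow> f c = g c"
    have R: "R0 f v = R0 g v" "R1 f v = R1 g v"
      unfolding R0_def R1_def using fg by (auto intro!: sum.cong)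
    show "F f v = F g v" by (simp only: F_def D_def W_def H_def R)
  qed
  then obtain f where "\<forall>v. f v = F f v" ..
  then have f: "fst (f v) = - D f v - W f v * R0 f v" "snd (f v) = 1 - D f v - W f v * R1 f v" for v
    by (metis F_def fst_conv, metis F_def snd_conv)
  \<comment> \<open>The contribution of the child \<open>c\<close> to \<open>H\<close> at its
    parent.\<close>
  define \<rho> where "\<rho> c = (if c \<in> Par Z1 then 0 else 1 / snd (f c)) - (if c \<in> Par Z0 then 0 else 1 / fst (f c))" for c
  have H: "H f v = (\<Sum>c\<in>ch v. \<rho> c)" for v
  proof -
    have "R1 f v = (\<Sum>c\<in>ch v. if c \<in> Par Z1 then 0 else 1 / snd (f c))"
      unfolding R1_def by (intro sum.mono_neutral_cong_left) auto
    moreover have "R0 f v = (\<Sum>c\<in>ch v. if c \<in> Par Z0 then 0 else 1 / fst (f c))"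
      unfolding R0_def by (intro sum.mono_neutral_cong_left) auto
    ultimately show ?thesis by (simp add: H_def \<rho>_def sum_subtractf)
  qed
  have WH: "W f v * H f v < 1" if "\<not> (v \<in> Z0 \<and> v \<in> Z1)" for v
  proof -
    have "H f v < 2 * (\<bar>H f v\<bar> + 1)"
      using abs_ge_self[of "H f v"] abs_ge_zero[of "H f v"] unfolding distrib_left by linarith
    then show ?thesis using that by (auto simp: W_def)
  qed
  \<comment> \<open>Where finite, the pivot of such a \<open>c\<close> is negative at parameter 0
    and positive at parameter 1, so no term of \<open>\<rho> c\<close> is negative.\<close>
  have \<rho>_pos: "\<rho> c > 0" if c: "c \<notin> Z0" "c \<notin> Z1" "\<not> (c \<in> Par Z0 \<and> c \<in> Par Z1)" for c
  proof -
    have lt: "W f c * H f c < 1" using WH c by blast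
    consider "c \<in> Par Z0" "c \<notin> Par Z1" | "c \<notin> Par Z0" "c \<in> Par Z1" | "c \<notin> Par Z0" "c \<notin> Par Z1"
      using c(3) by blast
    then show ?thesis
    proof cases
      case 1
      then have "snd (f c) = 1" using c by (simp add: f D_def)
      then show ?thesis using 1 by (simp add: \<rho>_def)
    next
      case 2
      then have "fst (f c) = -1" using c by (simp add: f D_def)
      then show ?thesis using 2 by (simp add: \<rho>_def)
    next
      case 3
      then have "fst (f c) = - (1 - W f c * H f c) / 2" "snd (f c) = (1 - W f c * H f c) / 2"
        using c by (simp_all add: f D_def H_def field_simps)
      then have "fst (f c) < 0" "snd (f c) > 0" using lt by simp_all
      then have "1 / fst (f c) < 1 / snd (f c)" by (meson less_trans zero_less_divide_1_iff divide_less_0_1_iff)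
      then show ?thesis using 3 by (simp add: \<rho>_def)
    qed
  qed
  \<comment> \<open>Validity keeps the children of \<open>v\<close> out of both zero sets, so all
    terms are nonnegative; the child from \<open>both\<close> gives a positive one.\<close>
  have H_pos: "H f v > 0" if v: "v \<in> Z0" "v \<in> Z1" for v
  proof -
    have nz: "c \<notin> Z0" "c \<notin> Z1" if "c \<in> ch v" for c
      using v that valid_disjoint[OF Z0 v(1)] valid_disjoint[OF Z1 v(2)] Par_iff[OF Z0] Par_iff[OF Z1] by auto
    obtain c where c: "c \<in> ch v" "\<not> (c \<in> Par Z0 \<and> c \<in> Par Z1)" using both[OF v] by blast
    have "0 \<le> \<rho> i" if "i \<in> ch v" for i
    proof (cases "i \<in> Par Z0 \<and> i \<in> Par Z1")
      case False
      then show ?thesis using \<rho>_pos[OF nz[OF that]] by simp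
    qed (simp add: \<rho>_def)
    then show ?thesis unfolding H using c \<rho>_pos[OF nz[OF c(1)] c(2)] by (intro sum_pos2[of _ c]) auto
  qed
  have W_pos: "W f v > 0" for v
    unfolding W_def using H_pos by (simp add: add_nonneg_pos)
  define A where "A = mat n n (\<lambda>(i, j). if i = j then D f i else if j \<in> ch i then sqrt (W f i)
    else if i \<in> ch j then sqrt (W f j) else 0)"
  have A: "A \<in> S_T n E"
    unfolding S_T_def
  proof (intro CollectI conjI allI impI)
    show "A \<in> carrier_mat n n" by (simp add: A_def)
    show "transpose_mat A = A"
      by (rule eq_matI) (use ch_asym in \<open>auto simp: A_def\<close>)
    show "A $$ (i, j) \<noteq> 0 \<longleftrightarrow> {i, j} \<in> E" if "i < n" "j < n" "i \<noteq> j" for i j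
      unfolding edge_iff[OF that(1,2)] using that W_pos[of i] W_pos[of j] by (auto simp: A_def)
  qed
  have diag: "A $$ (v, v) = D f v" if "v < n" for v using that by (simp add: A_def)
  have sq: "(A $$ (v, c))\<^sup>2 = W f v" if "v < n" "c \<in> ch v" for v c
    using that ch_less[OF that(2)] ch_irrefl[of v] W_pos[of v] by (auto simp: A_def)
  have "labelling A 0 Z0 (\<lambda>v. fst (f v))"
    unfolding labelling_def
  proof (intro conjI Z0 allI impI)
    fix v assume v: "v < n" "v \<notin> Par Z0"
    have "(\<Sum>c\<in>ch v - Par Z0. (A $$ (v, c))\<^sup>2 / fst (f c)) = W f v * R0 f v"
      unfolding R0_def sum_distrib_left using sq[OF v(1)] by (intro sum.cong) auto
    then show "fst (f v) = 0 - A $$ (v, v) - (\<Sum>c\<in>ch v - Par Z0. (A $$ (v, c))\<^sup>2 / fst (f c))"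
      by (simp add: f diag v)
    show "fst (f v) = 0 \<longleftrightarrow> v \<in> Z0"
    proof (cases "v \<in> Z0")
      case False
      then have "W f v * R1 f v - W f v * R0 f v < 1" using WH[of v] by (simp add: H_def right_diff_distrib)
      then show ?thesis using False v by (auto simp: f D_def H_def right_diff_distrib)
    qed (simp add: f D_def)
  qed
  moreover have "labelling A 1 Z1 (\<lambda>v. snd (f v))"
    unfolding labelling_def
  proof (intro conjI Z1 allI impI)
    fix v assume v: "v < n" "v \<notin> Par Z1"
    have "(\<Sum>c\<in>ch v - Par Z1. (A $$ (v, c))\<^sup>2 / snd (f c)) = W f v * R1 f v"
      unfolding R1_def sum_distrib_left using sq[OF v(1)] by (intro sum.cong) auto
    then show "snd (f v) = 1 - A $$ (v, v) - (\<Sum>c\<in>ch v - Par Z1. (A $$ (v, c))\<^sup>2 / snd (f c))"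
      by (simp add: f diag v)
    show "snd (f v) = 0 \<longleftrightarrow> v \<in> Z1"
    proof (cases "v \<in> Z0 \<and> v \<in> Z1")
      case True
      then have "W f v * R1 f v - W f v * R0 f v = 1"
        using H_pos[of v] unfolding right_diff_distrib[symmetric] H_def[symmetric] by (simp add: W_def)
      then show ?thesis using True by (simp add: f D_def)
    next
      case False
      then have "W f v * R1 f v - W f v * R0 f v < 1" using WH[of v] by (simp add: H_def right_diff_distrib)
      then show ?thesis using False v by (auto simp: f D_def H_def right_diff_distrib field_simps)
    qed
  qed
  ultimately show thesis using that[OF A] mult_labelling[OF A] by blast
qed

section \<open>The combinatorial formula for M(T)\<close>

lemma mult_le: "A \<in> S_T n E \<Longrightarrow> mult A x \<le> n"
proof -
  assume A: "A \<in> S_T n E"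
  obtain Z a where lab: "labelling A x Z a" using labelling_exists[OF A] .
  then have "Z \<subseteq> {..<n}" by (simp add: labelling_def valid_def)
  then have "card Z \<le> n" using card_mono[of "{..<n}" Z] by simp
  then show ?thesis using mult_labelling[OF A lab] by simp
qed

text \<open>\<open>Sup\<close> on the naturals is a maximum once the set is nonempty and bounded; a
  matrix comes from \<open>realize_pair\<close> with empty zero sets, the bound from
  \<open>mult_le\<close>.\<close>

lemma M_T_is_Max:
  shows "M_T n E \<in> {mult A x | A x. A \<in> S_T n E}"
    and "B \<in> S_T n E \<Longrightarrow> mult B y \<le> M_T n E"
proof -
  let ?S = "{mult A x | A x. A \<in> S_T n E}"
  have "valid {}" by (simp add: valid_def)
  then obtain A where "A \<in> S_T n E" using realize_pair[of "{}" "{}"] by blast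
  then have ne: "?S \<noteq> {}" by blast
  have "?S \<subseteq> {..n}" using mult_le by blast
  then have fin: "finite ?S" by (rule finite_subset) simp
  have M: "M_T n E = Max ?S" unfolding M_T_def by (rule cSup_eq_Max[OF fin ne])
  show "M_T n E \<in> ?S" unfolding M by (rule Max_in[OF fin ne])
  show "mult B y \<le> M_T n E" if "B \<in> S_T n E"
    unfolding M by (rule Max_ge[OF fin]) (use that in blast)
qed

text \<open>Paired with the empty set, any valid \<open>Z\<close> meets the side condition of
  \<open>realize_pair\<close>. Together with \<open>M_T_eq_card\<close> this expresses M(T) through
  zero sets.\<close>

lemma card_le_M_T: "valid Z \<Longrightarrow> card Z \<le> M_T n E + card (Par Z)"
proof -
  assume Z: "valid Z"
  have "valid {}" by (simp add: valid_def)
  then obtain A where A: "A \<in> S_T n E" "mult A 0 + card (Par Z) = card Z"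
    using realize_pair[OF Z, of "{}"] by blast
  have "mult A 0 \<le> M_T n E" using A(1) by (rule M_T_is_Max(2))
  then show ?thesis using A(2) by simp
qed

lemma M_T_eq_card:
  obtains Z where "valid Z" "card Z = M_T n E + card (Par Z)"
proof -
  obtain A x where A: "A \<in> S_T n E" "mult A x = M_T n E" using M_T_is_Max(1) by force
  obtain Z a where lab: "labelling A x Z a" using labelling_exists[OF A(1)] .
  then have "valid Z" by (simp add: labelling_def)
  then show thesis using that mult_labelling[OF A(1) lab] A(2) by simp
qed


section \<open>Splitting and minimising zero sets\<close>

lemma card_valid:
  assumes "valid Z"
  shows "card Z = (\<Sum>p\<in>Par Z. card (ch p \<inter> Z)) + card (Z \<inter> {r})"
proof -
  have fin: "finite Z" using assms by (rule finite_valid)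
  have "Z - {r} = (\<Union>p\<in>Par Z. ch p \<inter> Z)"
    using assms unfolding Par_def ch_def valid_def by auto
  moreover have "card (\<Union>p\<in>Par Z. ch p \<inter> Z) = (\<Sum>p\<in>Par Z. card (ch p \<inter> Z))"
    using fin by (intro card_UN_disjoint) (auto simp: Par_def ch_def)
  ultimately have "card (Z - {r}) = (\<Sum>p\<in>Par Z. card (ch p \<inter> Z))" by simp
  moreover have "card Z = card (Z - {r}) + card (Z \<inter> {r})"
    using card_Int_Diff[OF fin, of "{r}"] by simp
  ultimately show ?thesis by simp
qed

text \<open>Whole groups of siblings move to \<open>Z1\<close>, so their parents move along with
  them and both cardinalities split additively.\<close>

lemma split_valid:
  assumes Z: "valid Z" and Q: "Q \<subseteq> Par Z"
  defines "Z1 \<equiv> Z \<inter> (\<Union>q\<in>Q. ch q)"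
  shows "valid Z1" "valid (Z - Z1)" "Par Z1 = Q" "Par (Z - Z1) = Par Z - Q"
    "card Z1 = (\<Sum>q\<in>Q. card (ch q \<inter> Z))"
proof -
  have mem: "v \<in> Z1 \<longleftrightarrow> v \<in> Z \<and> v \<noteq> r \<and> par v \<in> Q" for v
    using Z unfolding Z1_def ch_def valid_def by auto
  show P1: "Par Z1 = Q"
  proof
    show "Par Z1 \<subseteq> Q" unfolding Par_def by (auto simp: mem)
    show "Q \<subseteq> Par Z1"
    proof
      fix q assume "q \<in> Q"
      then obtain v where "v \<in> Z" "v \<noteq> r" "q = par v" using Q unfolding Par_def by auto
      with \<open>q \<in> Q\<close> show "q \<in> Par Z1" unfolding Par_def by (auto simp: mem)
    qed
  qed
  show P2: "Par (Z - Z1) = Par Z - Q" unfolding Par_def by (auto simp: mem)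
  show v1: "valid Z1" using Z Q unfolding valid_def P1 by (auto simp: mem)
  show "valid (Z - Z1)" using Z unfolding valid_def P2 by auto
  have "r \<notin> Z1" by (simp add: mem)
  moreover have "ch q \<inter> Z1 = ch q \<inter> Z" if "q \<in> Q" for q using that by (auto simp: Z1_def)
  ultimately show "card Z1 = (\<Sum>q\<in>Q. card (ch q \<inter> Z))"
    using card_valid[OF v1] by (simp add: P1)
qed

text \<open>In an optimal set of least size no parent has a single child in \<open>Z\<close>:
  removing that child would remove the parent from \<open>Par Z\<close> too and leave the difference
  unchanged.\<close>

lemma optimal_set:
  obtains Z where "valid Z" "card Z = M_T n E + card (Par Z)"
    and "\<And>p. p \<in> Par Z \<Longrightarrow> card (ch p \<inter> Z) \<ge> 2"
proof -
  let ?P = "\<lambda>Z. valid Z \<and> card Z = M_T n E + card (Par Z)"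
  obtain Z' where "?P Z'" by (rule M_T_eq_card) blast
  from ex_has_least_nat[of ?P, OF this, of card]
  obtain Z where Z: "valid Z" "card Z = M_T n E + card (Par Z)"
    and least: "\<And>Z'. ?P Z' \<Longrightarrow> card Z \<le> card Z'" by blast
  have finP: "finite (Par Z)" using Par_subset[OF Z(1)] finite_subset by blast
  have "card (ch p \<inter> Z) \<ge> 2" if p: "p \<in> Par Z" for p
  proof (rule ccontr)
    assume "\<not> card (ch p \<inter> Z) \<ge> 2"
    moreover have "card (ch p \<inter> Z) \<noteq> 0" using p Par_iff[OF Z(1)] by simp
    ultimately have one: "card (ch p \<inter> Z) = 1" by linarith
    define Z1 where "Z1 = Z \<inter> (\<Union>q\<in>{p}. ch q)"
    note sp = split_valid[OF Z(1), of "{p}", folded Z1_def]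
    have sub: "{p} \<subseteq> Par Z" using p by simp
    have "card Z1 = 1" using sp(5)[OF sub] one by simp
    moreover have "card (Z - Z1) = card Z - card Z1"
      using finite_valid[OF Z(1)] by (intro card_Diff_subset) (auto simp: Z1_def)
    moreover have "card (Par (Z - Z1)) = card (Par Z) - 1"
      using sp(4)[OF sub] p finP by simp
    moreover have "card (Par Z) > 0" using p finP by (auto simp: card_gt_0_iff)
    ultimately have "?P (Z - Z1)" "card (Z - Z1) < card Z" using sp(2)[OF sub] Z(2) by auto
    then show False using least by fastforce
  qed
  then show thesis using that Z by blast
qed

section \<open>Stars and the 3-NIM property\<close>

text \<open>The centre \<open>p\<close> need not be the root: otherwise \<open>p\<close> hangs below
  \<open>r\<close>, and \<open>r\<close> is one of the leaves of the star.\<close>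

lemma star_at:
  assumes p: "p < n" and leaves: "\<And>x. x = r \<or> x \<in> ch p \<Longrightarrow> x \<noteq> p \<Longrightarrow> ch x \<subseteq> {p}"
  shows "is_simple_star n E"
proof -
  have par: "par v = p \<or> v = p \<and> par v = r" if "v < n" "v \<noteq> r" for v
    using that
  proof (induction "dep v" arbitrary: v rule: less_induct)
    case less
    define u where "u = par v"
    have v: "v \<in> ch u" using less.prems by (simp add: ch_def u_def)
    show ?case
    proof (cases "u = p \<or> u = r")
      case True
      then show ?thesis using leaves[of r] v u_def by auto
    next
      case False
      have u: "u < n" using par_less less.prems by (simp add: u_def)
      have "dep u < dep v" using dep_ch[OF v] by simp
      from less.hyps[OF this u] False have "par u = p" by blast
      \<comment> \<open>By hypothesis the only possible child of \<open>u\<close> is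
        \<open>p\<close>, but \<open>p\<close> is already the parent of \<open>u\<close>.\<close>
      then have up: "u \<in> ch p" using u False by (simp add: ch_def)
      then have "v = p" using leaves[of u] False v by auto
      then show ?thesis using ch_asym[OF v] up by simp
    qed
  qed
  have "E = {{p, v} | v. v < n \<and> v \<noteq> p}"
  proof (intro equalityI subsetI)
    fix e assume "e \<in> E"
    then obtain v where v: "v < n" "v \<noteq> r" "e = {v, par v}" unfolding edges by blast
    have ne: "par v \<noteq> v" by (rule par_neq[OF v(1,2)])
    from par[OF v(1,2)] show "e \<in> {{p, v} | v. v < n \<and> v \<noteq> p}"
    proof
      assume "par v = p"
      then show ?thesis using v ne by (intro CollectI exI[of _ v]) auto
    next
      assume "v = p \<and> par v = r"
      then show ?thesis using v r_less by (intro CollectI exI[of _ r]) auto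
    qed
  next
    fix e assume "e \<in> {{p, v} | v. v < n \<and> v \<noteq> p}"
    then obtain v where v: "v < n" "v \<noteq> p" "e = {p, v}" by blast
    show "e \<in> E"
    proof (cases "v = r")
      case True
      then have "p \<noteq> r" using v by simp
      then have "par p = r" using par[OF p] par_neq[OF p] by auto
      then show ?thesis using True v p \<open>p \<noteq> r\<close> unfolding edges
        by (intro CollectI exI[of _ p]) auto
    next
      case False
      then have "par v = p" using par[OF v(1) False] v by auto
      then show ?thesis using False v unfolding edges by (intro CollectI exI[of _ v]) auto
    qed
  qed
  then show ?thesis using p unfolding is_simple_star_def by blast
qed

lemma not_star_not_three_NIM:
  assumes M: "M_T n E \<ge> 4" and ns: "\<not> is_simple_star n E"
  shows "\<not> three_NIM n E"
proof -
  \<comment> \<open>What \<open>realize_pair\<close> needs to produce the multiplicities M - 2 at 0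
    and 2 at 1.\<close>
  define good where "good Z0 Z1 \<longleftrightarrow> valid Z0 \<and> valid Z1 \<and>
    (\<forall>v\<in>Z0 \<inter> Z1. \<exists>c\<in>ch v. \<not> (c \<in> Par Z0 \<and> c \<in> Par Z1)) \<and>
    card Z0 = M_T n E - 2 + card (Par Z0) \<and> card Z1 = 2 + card (Par Z1)" for Z0 Z1
  obtain Z where Z: "valid Z" "card Z = M_T n E + card (Par Z)"
    and two: "\<And>p. p \<in> Par Z \<Longrightarrow> card (ch p \<inter> Z) \<ge> 2" by (rule optimal_set) blast
  have finZ: "finite Z" using Z(1) by (rule finite_valid)
  have finP: "finite (Par Z)" using Par_subset[OF Z(1)] finite_subset by blast
  \<comment> \<open>The two parts are disjoint, so the condition on common zeros is vacuous, and the
    surplus 2 moves to \<open>Z1\<close>.\<close>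
  have splitting: "\<exists>Z0 Z1. good Z0 Z1"
    if Q: "Q \<subseteq> Par Z" and sum: "(\<Sum>q\<in>Q. card (ch q \<inter> Z)) = 2 + card Q" for Q
  proof -
    define Z1 where "Z1 = Z \<inter> (\<Union>q\<in>Q. ch q)"
    note sp = split_valid[OF Z(1) Q, folded Z1_def]
    have "card (Z - Z1) = card Z - card Z1"
      using finZ by (intro card_Diff_subset) (auto simp: Z1_def)
    moreover have "card (Par Z - Q) = card (Par Z) - card Q"
      using finP Q by (intro card_Diff_subset) (auto intro: finite_subset)
    moreover have "card Q \<le> card (Par Z)" using finP Q by (rule card_mono)
    ultimately have "good (Z - Z1) Z1"
      unfolding good_def using sp sum Z(2) M by auto
    then show ?thesis by blast
  qed
  have "\<exists>Z0 Z1. good Z0 Z1"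
  proof (cases "\<exists>p\<in>Par Z. card (ch p \<inter> Z) \<ge> 4")
    case True
    then obtain p where p: "p \<in> Par Z" "card (ch p \<inter> Z) \<ge> 4" by blast
    then have "p < n" using Par_subset[OF Z(1)] by auto
    from star_at[OF this] ns obtain x where x: "x = r \<or> x \<in> ch p" "x \<noteq> p" "\<not> ch x \<subseteq> {p}" by blast
    \<comment> \<open>Two of these three children are handed over; the third keeps \<open>p\<close>
      in \<open>Par Z0\<close>.\<close>
    have "card (ch p \<inter> Z - {x}) \<ge> 3" using p(2) finZ by (cases "x \<in> ch p \<inter> Z") auto
    then obtain U where U: "U \<subseteq> ch p \<inter> Z - {x}" "card U = 3"
      by (meson obtain_subset_with_card_n)
    then obtain u1 u2 u3 where "U = {u1, u2, u3}" and u: "u1 \<noteq> u2" "u3 \<noteq> u1" "u3 \<noteq> u2"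
      by (auto simp: card_3_iff)
    then have mem: "u1 \<in> ch p" "u2 \<in> ch p" "u3 \<in> ch p" "u1 \<in> Z" "u2 \<in> Z" "u3 \<in> Z" "u1 \<noteq> x" "u2 \<noteq> x"
      using U by auto
    have up: "u1 \<noteq> r" "u2 \<noteq> r" "u3 \<noteq> r" "par u1 = p" "par u2 = p" "par u3 = p" "u1 < n" "u2 < n"
      using mem by (auto simp: ch_def)
    define Z0 where "Z0 = Z - {u1, u2}"
    define Z1 where "Z1 = {x, u1, u2}"
    have "Par Z0 = Par Z"
    proof
      show "Par Z \<subseteq> Par Z0"
      proof
        fix q assume "q \<in> Par Z"
        then obtain v where v: "v \<in> Z" "v \<noteq> r" "q = par v" unfolding Par_def by auto
        show "q \<in> Par Z0"
        proof (cases "v \<in> {u1, u2}")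
          case True
          then have "q = par u3" using v up by auto
          moreover have "u3 \<in> Z0 - {r}" using mem up u by (auto simp: Z0_def)
          ultimately show ?thesis unfolding Par_def by (rule image_eqI)
        next
          case False
          then show ?thesis using v unfolding Par_def Z0_def by auto
        qed
      qed
    qed (auto simp: Par_def Z0_def)
    \<comment> \<open>\<open>x\<close> adds no parent, so three zeros face one pole: surplus
      2.\<close>
    moreover have P1: "Par Z1 = {p}"
      using x(1) up unfolding Par_def Z1_def ch_def by auto
    moreover have "valid Z0" using Z(1) \<open>Par Z0 = Par Z\<close> unfolding valid_def Z0_def by auto
    moreover have "valid Z1"
    proof -
      have "x < n" using x(1) r_less ch_less by blast
      moreover have "u1 \<noteq> p" "u2 \<noteq> p" using mem(1,2) ch_irrefl by blast+
      ultimately show ?thesis unfolding valid_def P1 using x(2) up by (auto simp: Z1_def)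
    qed
    moreover have "card Z0 = card Z - 2"
      using mem u finZ unfolding Z0_def by (subst card_Diff_subset) auto
    moreover have "card Z1 = 3" using mem u unfolding Z1_def by auto
    \<comment> \<open>Only \<open>x\<close> can be common to both sets, and it has a child outside
      \<open>Par Z1\<close>.\<close>
    moreover have "\<exists>c\<in>ch v. \<not> (c \<in> Par Z0 \<and> c \<in> Par Z1)" if "v \<in> Z0 \<inter> Z1" for v
    proof -
      have "v = x" using that by (auto simp: Z0_def Z1_def)
      then show ?thesis using x(3) P1 by auto
    qed
    ultimately have "good Z0 Z1" unfolding good_def using Z(2) M by auto
    then show ?thesis by blast
  next
    case no4: False
    show ?thesis
    proof (cases "\<exists>p\<in>Par Z. card (ch p \<inter> Z) = 3")
      case True
      then obtain p where "p \<in> Par Z" "card (ch p \<inter> Z) = 3" by blast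
      then show ?thesis by (intro splitting[of "{p}"]) auto
    next
      case False
      then have eq2: "card (ch p \<inter> Z) = 2" if "p \<in> Par Z" for p
      proof -
        have "card (ch p \<inter> Z) \<noteq> 3" "\<not> 4 \<le> card (ch p \<inter> Z)" using False no4 that by blast+
        with two[OF that] show ?thesis by linarith
      qed
      have "card (Z \<inter> {r}) \<le> 1" using card_mono[of "{r}" "Z \<inter> {r}"] by simp
      moreover have "(\<Sum>p\<in>Par Z. card (ch p \<inter> Z)) = 2 * card (Par Z)" using eq2 by simp
      \<comment> \<open>Here \<open>M + |Par Z| = |Z|\<close> is at most
        \<open>2 |Par Z| + 1\<close>, and M is at least 4.\<close>
      ultimately have "card (Par Z) \<ge> 2" using card_valid[OF Z(1)] Z(2) M by linarith
      then obtain Q where Q: "Q \<subseteq> Par Z" "card Q = 2" by (meson obtain_subset_with_card_n)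
      have "(\<Sum>q\<in>Q. card (ch q \<inter> Z)) = (\<Sum>q\<in>Q. 2)" using Q(1) eq2 by (intro sum.cong) auto
      then show ?thesis using Q by (intro splitting[of Q]) auto
    qed
  qed
  then obtain Z0 Z1 where g: "good Z0 Z1" by blast
  then obtain A where A: "A \<in> S_T n E" "mult A 0 + card (Par Z0) = card Z0" "mult A 1 + card (Par Z1) = card Z1"
    using realize_pair[of Z0 Z1] unfolding good_def by blast
  then have "mult A 0 = M_T n E - 2" "mult A 1 = 2" using g unfolding good_def by simp_all
  show ?thesis
  proof
    assume "three_NIM n E"
    then have "mult A 0 = M_T n E - 2 \<and> M_T n E - 2 \<ge> 2 \<longrightarrow> (1::real) \<noteq> 0 \<and> mult A 1 \<ge> 1 \<longrightarrow> mult A 1 = 1"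
      using A(1) unfolding three_NIM_def by blast
    then show False using \<open>mult A 0 = M_T n E - 2\<close> \<open>mult A 1 = 2\<close> M by simp
  qed
qed

text \<open>An eigenvalue of multiplicity m at least 2 is the diagonal entry of m + 1 leaves.
  Multiplicities M - 2 and at least 2 would thus use at least (M - 1) + 3 distinct leaves, but the
  set of all leaves shows that there are at most M + 1.\<close>

lemma star_three_NIM:
  assumes star: "\<And>v. v < n \<Longrightarrow> v \<noteq> r \<Longrightarrow> par v = r" and M: "M_T n E \<ge> 4"
  shows "three_NIM n E"
proof -
  have leaf: "ch v = {}" if "v \<noteq> r" for v using that star by (auto simp: ch_def)
  have Par_sub: "Par Z \<subseteq> {r}" if "Z \<subseteq> {..<n}" for Z using that star by (auto simp: Par_def)
  have leaves: "Z \<subseteq> {..<n} - {r} \<and> card Z = m + 1 \<and> (\<forall>l\<in>Z. A $$ (l, l) = x)"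
    if lab: "labelling A x Z a" and A: "A \<in> S_T n E" and m: "mult A x = m" "m \<ge> 2" for A x Z a m
  proof -
    have Z: "valid Z" using lab by (simp add: labelling_def)
    then have sub: "Z \<subseteq> {..<n}" by (simp add: valid_def)
    have c: "m + card (Par Z) = card Z" using mult_labelling[OF A lab] m(1) by simp
    then have "\<not> Z \<subseteq> {r}" using m(2) card_mono[of "{r}" Z] by auto
    then obtain z where "z \<in> Z" "z \<noteq> r" by auto
    then have "r \<in> Par Z" using star[of z] sub by (force simp: Par_def)
    then have P: "Par Z = {r}" using Par_sub[OF sub] by auto
    then have ss: "Z \<subseteq> {..<n} - {r}" using Z by (auto simp: valid_def)
    have "A $$ (l, l) = x" if "l \<in> Z" for l
    proof -
      have l: "l < n" "l \<noteq> r" using ss that by auto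
      then have "a l = x - A $$ (l, l)" "a l = 0" using lab leaf[OF l(2)] P that by (auto simp: labelling_def)
      then show ?thesis by simp
    qed
    then show ?thesis using ss c P by simp
  qed
  have lower: "n - 1 \<le> M_T n E + 1"
  proof -
    let ?L = "{..<n} - {r}"
    have P: "Par ?L \<subseteq> {r}" by (rule Par_sub) auto
    then have "valid ?L" unfolding valid_def by auto
    from card_le_M_T[OF this] have "n - 1 \<le> M_T n E + card (Par ?L)" using r_less by simp
    moreover have "card (Par ?L) \<le> 1" using card_mono[OF _ P] by simp
    ultimately show ?thesis by linarith
  qed
  have False_if: False if A: "A \<in> S_T n E" and x: "mult A x = M_T n E - 2" and y: "y \<noteq> x" "mult A y \<ge> 2" for A x y
  proof -
    obtain Z a where Z: "labelling A x Z a" using labelling_exists[OF A] .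
    obtain Z' a' where Z': "labelling A y Z' a'" using labelling_exists[OF A] .
    have l: "Z \<subseteq> {..<n} - {r}" "card Z = M_T n E - 2 + 1" "\<forall>l\<in>Z. A $$ (l, l) = x"
      using leaves[OF Z A x] M by auto
    have l': "Z' \<subseteq> {..<n} - {r}" "card Z' = mult A y + 1" "\<forall>l\<in>Z'. A $$ (l, l) = y"
      using leaves[OF Z' A refl y(2)] by auto
    have "Z \<inter> Z' = {}" using l(3) l'(3) y(1) by auto
    then have "card Z + card Z' = card (Z \<union> Z')"
      using l(1) l'(1) by (intro card_Un_disjoint[symmetric]) (auto intro: finite_subset)
    also have "\<dots> \<le> card ({..<n} - {r})" using l(1) l'(1) by (intro card_mono) auto
    also have "\<dots> = n - 1" using r_less by simp
    finally show False using l(2) l'(2) y(2) lower M by linarith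
  qed
  have "mult A y = 1"
    if "A \<in> S_T n E" "mult A x = M_T n E - 2" "y \<noteq> x" "mult A y \<ge> 1" for A x y
  proof (rule ccontr)
    assume "mult A y \<noteq> 1"
    with that(4) have "mult A y \<ge> 2" by linarith
    with False_if[OF that(1-3)] show False .
  qed
  then show ?thesis unfolding three_NIM_def using M by auto
qed

end

section \<open>Rooting a tree, and the equivalence\<close>

text \<open>Depth is the distance from \<open>r\<close>, and a parent is a neighbour one step
  closer. The edges to parents are n - 1 distinct ones, hence all of \<open>E\<close>.\<close>

lemma is_tree_rooted:
  assumes T: "is_tree n E" and r: "r < n"
  obtains par dep where "rooted_tree n r par dep E"
proof -
  have G: "graph_on n E" "connected_graph n E" "finite E" "card E = n - 1" using T by (auto simp: is_tree_def)
  define dep where "dep v = (LEAST k. (adj E ^^ k) r v)" for v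
  have reach: "\<exists>k. (adj E ^^ k) r v" if "v < n" for v
    using G(2) r that unfolding connected_graph_def by (auto simp: rtranclp_power)
  have dep: "(adj E ^^ dep v) r v" if "v < n" for v
    unfolding dep_def using reach[OF that] by (rule LeastI_ex)
  have dep_le: "dep v \<le> k" if "(adj E ^^ k) r v" for v k
    unfolding dep_def using that by (rule Least_le)
  have "\<exists>u<n. {v, u} \<in> E \<and> dep v = Suc (dep u)" if v: "v < n" "v \<noteq> r" for v
  proof -
    have "dep v \<noteq> 0" using dep[OF v(1)] v(2) by (metis relpowp_0_E)
    then obtain k where k: "dep v = Suc k" by (cases "dep v") auto
    with dep[OF v(1)] obtain u where u: "(adj E ^^ k) r u" "adj E u v" by (auto elim: relpowp_Suc_E)
    have e: "{u, v} \<in> E" using u(2) by (simp add: adj_def)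
    then have "u < n" using G(1) unfolding graph_on_def by (metis doubleton_eq_iff)
    have "dep v \<le> Suc (dep u)" using dep[OF \<open>u < n\<close>] u(2) by (intro dep_le) auto
    moreover have "dep u \<le> k" using u(1) by (rule dep_le)
    ultimately have "dep v = Suc (dep u)" using k by simp
    then show ?thesis using \<open>u < n\<close> e by (auto simp: insert_commute)
  qed
  then obtain par where par: "\<And>v. v < n \<Longrightarrow> v \<noteq> r \<Longrightarrow> par v < n \<and> {v, par v} \<in> E \<and> dep v = Suc (dep (par v))"
    by metis
  let ?V = "{..<n} - {r}"
  have inj: "inj_on (\<lambda>v. {v, par v}) ?V"
  proof (rule inj_onI)
    fix v w assume vw: "v \<in> ?V" "w \<in> ?V" "{v, par v} = {w, par w}"
    show "v = w"
    proof (rule ccontr)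
      assume "v \<noteq> w"
      then have "v = par w \<and> par v = w" using vw(3) by (simp only: doubleton_eq_iff) blast
      then have "dep v = dep (par w)" "dep (par v) = dep w" by (blast intro: arg_cong)+
      moreover have "dep v = Suc (dep (par v))" using par[of v] vw(1) by blast
      moreover have "dep w = Suc (dep (par w))" using par[of w] vw(2) by blast
      ultimately show False by linarith
    qed
  qed
  have "(\<lambda>v. {v, par v}) ` ?V = E"
  proof (rule card_subset_eq[OF G(3)])
    show "(\<lambda>v. {v, par v}) ` ?V \<subseteq> E" using par by auto
    show "card ((\<lambda>v. {v, par v}) ` ?V) = card E" using card_image[OF inj] r G(4) by simp
  qed
  then have "E = {{v, par v} | v. v < n \<and> v \<noteq> r}" by auto
  then have "rooted_tree n r par dep E"
    using r par by unfold_locales auto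
  then show thesis by (rule that)
qed

theorem theorem2p4:
  fixes n :: nat and E :: "nat set set"
  assumes "is_tree n E" and "M_T n E \<ge> 4"
  shows "three_NIM n E \<longleftrightarrow> is_simple_star n E"
proof
  assume NIM: "three_NIM n E"
  have "0 < n" using assms(1) by (simp add: is_tree_def)
  then obtain par dep where "rooted_tree n 0 par dep E" using is_tree_rooted[OF assms(1)] by blast
  then show "is_simple_star n E"
    using rooted_tree.not_star_not_three_NIM assms(2) NIM by blast
next
  assume "is_simple_star n E"
  then obtain c where c: "c < n" "E = {{c, v} | v. v < n \<and> v \<noteq> c}" unfolding is_simple_star_def by blast
  \<comment> \<open>With the root at the centre, every other vertex is a child of the root.\<close>
  obtain par dep where tree: "rooted_tree n c par dep E" using is_tree_rooted[OF assms(1) c(1)] .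
  have "par v = c" if "v < n" "v \<noteq> c" for v
  proof -
    have "{v, par v} \<in> E" using rooted_tree.edges[OF tree] that by blast
    then show ?thesis using c(2) that by (auto simp: doubleton_eq_iff)
  qed
  then show "three_NIM n E" using rooted_tree.star_three_NIM[OF tree _ assms(2)] by blast
qed

end
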